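(* Let $A\in\mathbb{R}^{d\times d}$ be invertible, $\bm{b}\in\mathbb{R}^d$, $\bm{x}^\ast=A^{-1}\bm{b}$, $\bm{x}_0\in\mathbb{R}^d$ with $\bm{x}_0\ne\bm{x}^\ast$, $\Sigma_0$ symmetric positive-definite. Let $\bm{x}_m$ be the BayesCG mean defined by the recursion: $\bm{r}_0=\bm{b}-A\bm{x}_0$, $\tilde{\bm{s}}_1=\bm{r}_0$, $\bm{s}_k=\tilde{\bm{s}}_k/\|\tilde{\bm{s}}_k\|_{A\Sigma_0A^\top}$, $\bm{x}_k=\bm{x}_0+\Sigma_0A^\top S_k\Lambda_k^{-1}S_k^\top\bm{r}_0$ with $S_k=[\bm{s}_1,\dots,\bm{s}_k]$, $\Lambda_k=S_k^\top A\Sigma_0A^\top S_k$, $\bm{r}_k=\bm{b}-A\bm{x}_k$, $\tilde{\bm{s}}_{k+1}=\bm{r}_k-\langle\bm{s}_k,\bm{r}_k\rangle_{A\Sigma_0A^\top}\bm{s}_k$, assuming $\tilde{\bm{s}}_1,\dots,\tilde{\bm{s}}_m\ne\bm{0}$. Let $\kappa=\kappa(\Sigma_0A^\top A)=\|\Sigma_0A^\top A\|_2\,\|(\Sigma_0A^\top A)^{-1}\|_2$. Then \[\frac{\|\bm{x}_m-\bm{x}^\ast\|_{\Sigma_0^{-1}}}{\|\bm{x}_0-\bm{x}^\ast\|_{\Sigma_0^{-1}}}\le2\left(\frac{\sqrt{\kappa}-1}{\sqrt{\kappa}+1}\right)^m.\]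
   Context: $\langle\bm{u},\bm{v}\rangle_{B}=\bm{u}^\top B\bm{v}$, $\|\bm{v}\|_B=\sqrt{\bm{v}^\top B\bm{v}}$ for symmetric positive-definite $B$; $\|\cdot\|_2$ is the matrix operator 2-norm. *)

theory Defs
  imports "HOL-Analysis.Analysis"
begin

section \<open>Conventions\<close>

text \<open>Vectors in R^d are real^'n, d x d matrices are real^'n^'n.
  Small k x k matrices (k varies with the iteration) are represented as
  functions nat => nat => real, meaningful only on indices below k.\<close>

definition spd :: "real^'n^'n \<Rightarrow> bool" where
  "spd M \<longleftrightarrow> transpose M = M \<and> (\<forall>v. v \<noteq> 0 \<longrightarrow> v \<bullet> (M *v v) > 0)"

definition Binner :: "real^'n^'n \<Rightarrow> real^'n \<Rightarrow> real^'n \<Rightarrow> real" where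
  "Binner B u v = u \<bullet> (B *v v)"

definition Bnorm :: "real^'n^'n \<Rightarrow> real^'n \<Rightarrow> real" where
  "Bnorm B v = sqrt (v \<bullet> (B *v v))"

text \<open>Operator 2-norm of a matrix and the 2-norm condition number.\<close>
definition opnorm2 :: "real^'n^'n \<Rightarrow> real" where
  "opnorm2 M = onorm (\<lambda>v. M *v v)"

definition cond2 :: "real^'n^'n \<Rightarrow> real" where
  "cond2 M = opnorm2 M * opnorm2 (matrix_inv M)"

text \<open>k x k matrix product and inverse (entries outside {0..<k} are zero).\<close>
definition kmult :: "nat \<Rightarrow> (nat \<Rightarrow> nat \<Rightarrow> real) \<Rightarrow> (nat \<Rightarrow> nat \<Rightarrow> real) \<Rightarrow> nat \<Rightarrow> nat \<Rightarrow> real" where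
  "kmult k M N = (\<lambda>i j. \<Sum>l<k. M i l * N l j)"

definition kinv :: "nat \<Rightarrow> (nat \<Rightarrow> nat \<Rightarrow> real) \<Rightarrow> nat \<Rightarrow> nat \<Rightarrow> real" where
  "kinv k M = (THE N. (\<forall>i j. (k \<le> i \<or> k \<le> j) \<longrightarrow> N i j = 0)
      \<and> (\<forall>i<k. \<forall>j<k. kmult k N M i j = (if i = j then 1 else 0))
      \<and> (\<forall>i<k. \<forall>j<k. kmult k M N i j = (if i = j then 1 else 0)))"

section \<open>BayesCG\<close>

text \<open>Given the list Ss = [s_1,...,s_k] (stored at indices 0..k-1), the BayesCG mean
  x_k = x_0 + Sigma0 A^T S_k Lambda_k^{-1} S_k^T r_0,
  Lambda_k = S_k^T A Sigma0 A^T S_k.\<close>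
definition bcg_mean :: "real^'n^'n \<Rightarrow> real^'n^'n \<Rightarrow> real^'n \<Rightarrow> real^'n \<Rightarrow> (real^'n) list \<Rightarrow> real^'n" where
  "bcg_mean A Sig b x0 Ss =
     (let k = length Ss;
          B = A ** Sig ** transpose A;
          r0 = b - A *v x0;
          Lam = (\<lambda>i j. Ss ! i \<bullet> (B *v (Ss ! j)));
          StR = (\<lambda>j. Ss ! j \<bullet> r0);
          w = (\<lambda>i. \<Sum>j<k. kinv k Lam i j * StR j)
      in x0 + (Sig ** transpose A) *v (\<Sum>i<k. w i *\<^sub>R Ss ! i))"

text \<open>The list [stilde_1, ..., stilde_k] of unnormalised search directions.\<close>
fun bcg_stildes :: "real^'n^'n \<Rightarrow> real^'n^'n \<Rightarrow> real^'n \<Rightarrow> real^'n \<Rightarrow> nat \<Rightarrow> (real^'n) list" where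
  "bcg_stildes A Sig b x0 0 = []"
| "bcg_stildes A Sig b x0 (Suc k) =
     (let B = A ** Sig ** transpose A;
          Ts = bcg_stildes A Sig b x0 k;
          Ss = map (\<lambda>t. (1 / Bnorm B t) *\<^sub>R t) Ts;
          xk = bcg_mean A Sig b x0 Ss;
          rk = b - A *v xk;
          new = (if k = 0 then rk else rk - Binner B (last Ss) rk *\<^sub>R last Ss)
      in Ts @ [new])"

text \<open>stilde_k for k >= 1.\<close>
definition bcg_stilde :: "real^'n^'n \<Rightarrow> real^'n^'n \<Rightarrow> real^'n \<Rightarrow> real^'n \<Rightarrow> nat \<Rightarrow> real^'n" where
  "bcg_stilde A Sig b x0 k = bcg_stildes A Sig b x0 k ! (k - 1)"

text \<open>s_1, ..., s_k as a list.\<close>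
definition bcg_dirs :: "real^'n^'n \<Rightarrow> real^'n^'n \<Rightarrow> real^'n \<Rightarrow> real^'n \<Rightarrow> nat \<Rightarrow> (real^'n) list" where
  "bcg_dirs A Sig b x0 k =
     map (\<lambda>t. (1 / Bnorm (A ** Sig ** transpose A) t) *\<^sub>R t) (bcg_stildes A Sig b x0 k)"

text \<open>The BayesCG mean x_k.\<close>
definition bcg_x :: "real^'n^'n \<Rightarrow> real^'n^'n \<Rightarrow> real^'n \<Rightarrow> real^'n \<Rightarrow> nat \<Rightarrow> real^'n" where
  "bcg_x A Sig b x0 k = bcg_mean A Sig b x0 (bcg_dirs A Sig b x0 k)"

end

(* The matrix M = Sig A^T A is self-adjoint and positive for the inner product
   <u, v> = u^T Sig^-1 v.  The BayesCG directions form the (A Sig A^T)-orthonormal Lanczos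
   basis of the Krylov space of r_0, and the Galerkin condition S_m^T r_m = 0 makes the error
   x_m - x_star the <,>-smallest vector in x_0 - x_star + span {M^j (x_0 - x_star) : 1 <= j <= m}.
   So BayesCG is CG for M and the classical Chebyshev argument applies: the extreme Rayleigh
   quotients a <= b of M are eigenvalues, so b / a <= kappa, and with c = (b + a) / (b - a) and
   N = c - 2 M / (b - a) the vector T_m(N) (x_0 - x_star) / T_m(c) is admissible.  The bound
   ||T_m(N)|| <= 1 follows from ||N|| <= 1 and the Pell identity T_m^2 + (1 - x^2) U_(m-1)^2 = 1,
   without diagonalising M, while T_m(c) >= ((sqrt kappa + 1) / (sqrt kappa - 1))^m / 2. *)

theory Submission
  imports Defs
begin

section \<open>Symmetric positive definite matrices\<close>

lemma matrix_inv_right: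
  fixes X :: "'a::semiring_1^'n^'n"
  assumes "invertible X"
  shows "X ** matrix_inv X = mat 1"
  using someI_ex[OF assms[unfolded invertible_def]] unfolding matrix_inv_def by blast

lemma matrix_inv_left:
  fixes X :: "'a::semiring_1^'n^'n"
  assumes "invertible X"
  shows "matrix_inv X ** X = mat 1"
  using someI_ex[OF assms[unfolded invertible_def]] unfolding matrix_inv_def by blast

lemma matrix_vector_mul_inv_right:
  fixes X :: "'a::comm_semiring_1^'n^'n"
  assumes "invertible X"
  shows "X *v (matrix_inv X *v v) = v"
  by (simp add: matrix_vector_mul_assoc matrix_inv_right[OF assms])

lemma matrix_vector_mul_inv_left:
  fixes X :: "'a::comm_semiring_1^'n^'n"
  assumes "invertible X"
  shows "matrix_inv X *v (X *v v) = v"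
  by (simp add: matrix_vector_mul_assoc matrix_inv_left[OF assms])

lemma inner_matrix_transpose:
  fixes M :: "real^'n^'m"
  shows "(M *v x) \<bullet> y = x \<bullet> (transpose M *v y)"
  by (metis dot_lmul_matrix vector_transpose_matrix)

lemma eigenvalue_le_opnorm2:
  fixes M :: "real^'n^'n"
  assumes "M *v x = \<mu> *\<^sub>R x" and "x \<noteq> 0"
  shows "\<bar>\<mu>\<bar> \<le> opnorm2 M"
proof -
  have "norm (M *v x) \<le> opnorm2 M * norm x"
    unfolding opnorm2_def by (rule onorm) simp
  then show ?thesis using assms by simp
qed

lemma spd_symmetric: "spd S \<Longrightarrow> transpose S = S"
  by (simp add: spd_def)

lemma spd_pos: "spd S \<Longrightarrow> v \<noteq> 0 \<Longrightarrow> Binner S v v > 0"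
  by (simp add: spd_def Binner_def)

lemma spd_invertible:
  assumes "spd S" shows "invertible S"
proof -
  have "x = 0" if "S *v x = 0" for x
    using spd_pos[OF assms, of x] that by (auto simp: Binner_def)
  then show ?thesis using invertible_left_inverse matrix_left_invertible_ker by blast
qed

lemma spd_matrix_inv:
  assumes "spd S" shows "spd (matrix_inv S)"
proof -
  have inv: "invertible S" by (rule spd_invertible[OF assms])
  have "transpose (matrix_inv S) = transpose (matrix_inv S) ** (S ** matrix_inv S)"
    by (simp add: matrix_inv_right[OF inv])
  also have "\<dots> = transpose (S ** matrix_inv S) ** matrix_inv S"
    by (simp add: matrix_mul_assoc matrix_transpose_mul spd_symmetric[OF assms])
  also have "\<dots> = matrix_inv S"
    by (simp add: matrix_inv_right[OF inv])
  finally have sym: "transpose (matrix_inv S) = matrix_inv S" .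
  have "v \<bullet> (matrix_inv S *v v) > 0" if "v \<noteq> 0" for v
  proof -
    define u where "u = matrix_inv S *v v"
    have v: "v = S *v u" unfolding u_def by (simp add: matrix_vector_mul_inv_right[OF inv])
    then have "u \<noteq> 0" using that by auto
    then have "u \<bullet> (S *v u) > 0" using spd_pos[OF assms] by (simp add: Binner_def)
    then show ?thesis
      unfolding u_def[symmetric] v by (simp add: inner_commute matrix_vector_mul_inv_left[OF inv])
  qed
  then show ?thesis using sym by (simp add: spd_def)
qed

lemma spd_congruence:
  fixes A S :: "real^'n^'n"
  assumes "invertible A" and "spd S"
  shows "spd (A ** S ** transpose A)"
proof -
  have "v \<bullet> ((A ** S ** transpose A) *v v) > 0" if "v \<noteq> 0" for v
  proof -
    have "transpose A *v v \<noteq> 0"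
      using that matrix_vector_mul_inv_left[OF transpose_invertible[OF assms(1)], of v] by auto
    then have "(transpose A *v v) \<bullet> (S *v (transpose A *v v)) > 0"
      using spd_pos[OF assms(2)] by (simp add: Binner_def)
    moreover have "v \<bullet> (A *v w) = (transpose A *v v) \<bullet> w" for w
      using inner_matrix_transpose[of "transpose A" v w] by simp
    ultimately show ?thesis by (simp add: matrix_vector_mul_assoc[symmetric])
  qed
  then show ?thesis
    by (simp add: spd_def matrix_transpose_mul spd_symmetric[OF assms(2)] matrix_mul_assoc)
qed

lemma Binner_add_left: "Binner G (x + y) z = Binner G x z + Binner G y z"
  by (simp add: Binner_def inner_add_left)

lemma Binner_add_right: "Binner G x (y + z) = Binner G x y + Binner G x z"
  by (simp add: Binner_def inner_add_right matrix_vector_right_distrib)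

lemma Binner_diff_left: "Binner G (x - y) z = Binner G x z - Binner G y z"
  by (simp add: Binner_def inner_diff_left)

lemma Binner_diff_right: "Binner G x (y - z) = Binner G x y - Binner G x z"
  by (simp add: Binner_def inner_diff_right matrix_vector_mult_diff_distrib)

lemma Binner_scaleR_left: "Binner G (c *\<^sub>R x) y = c * Binner G x y"
  by (simp add: Binner_def)

lemma Binner_scaleR_right: "Binner G x (c *\<^sub>R y) = c * Binner G x y"
  by (simp add: Binner_def matrix_vector_mult_scaleR)

lemma Binner_zero [simp]: "Binner G 0 x = 0" "Binner G x 0 = 0"
  by (simp_all add: Binner_def)

lemmas Binner_bilinear = Binner_add_left Binner_add_right Binner_diff_left Binner_diff_right
  Binner_scaleR_left Binner_scaleR_right

lemma Bnorm_Binner: "Bnorm G v = sqrt (Binner G v v)"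
  by (simp add: Bnorm_def Binner_def)

section \<open>Krylov spaces and Chebyshev polynomials\<close>

definition krylov :: "('a::real_vector \<Rightarrow> 'a) \<Rightarrow> 'a \<Rightarrow> nat \<Rightarrow> 'a set" where
  "krylov f v j = span ((\<lambda>l. (f ^^ l) v) ` {..<j})"

lemma subspace_krylov: "subspace (krylov f v j)"
  unfolding krylov_def by (rule subspace_span)

lemma krylov_0 [simp]: "krylov f v 0 = {0}"
  by (simp add: krylov_def)

lemma krylov_mono: "j \<le> j' \<Longrightarrow> krylov f v j \<subseteq> krylov f v j'"
  unfolding krylov_def by (rule span_mono) auto

lemma krylov_power: "l < j \<Longrightarrow> (f ^^ l) v \<in> krylov f v j"
  unfolding krylov_def by (rule span_base) simp

lemma krylov_Suc: "krylov f v (Suc j) = span (insert ((f ^^ j) v) (krylov f v j))"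
  by (simp add: krylov_def lessThan_Suc span_insert span_span)

lemma krylov_image:
  assumes "linear f" and "x \<in> krylov f v j"
  shows "f x \<in> krylov f v (Suc j)"
proof -
  have "f ` krylov f v j = span (f ` (\<lambda>l. (f ^^ l) v) ` {..<j})"
    unfolding krylov_def using span_linear_image[OF assms(1)] by simp
  also have "\<dots> \<subseteq> krylov f v (Suc j)"
    unfolding krylov_def image_image
    by (rule span_mono) (auto intro!: image_eqI[where x = "Suc _"])
  finally show ?thesis using assms(2) by blast
qed

text \<open>\<^term>\<open>cheb_pair N e j\<close> is the pair \<open>(T\<^sub>j(N) e, U\<^sub>j\<^sub>-\<^sub>1(N) e)\<close> of
  Chebyshev polynomials of the first and second kind, computed by
  \<open>T\<^sub>j\<^sub>+\<^sub>1 = N T\<^sub>j + (N\<^sup>2 - 1) U\<^sub>j\<^sub>-\<^sub>1\<close> and \<open>U\<^sub>j = N U\<^sub>j\<^sub>-\<^sub>1 + T\<^sub>j\<close>.\<close>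
fun cheb_pair :: "('a::real_vector \<Rightarrow> 'a) \<Rightarrow> 'a \<Rightarrow> nat \<Rightarrow> 'a \<times> 'a" where
  "cheb_pair N e 0 = (e, 0)"
| "cheb_pair N e (Suc j) = (let (t, u) = cheb_pair N e j in (N t + (N (N u) - u), N u + t))"

lemma cheb_pair_scalar:
  fixes z w :: real
  assumes c: "c = (z + w) / 2" and zw: "z * w = 1" and "z \<noteq> w"
  shows "cheb_pair ((*) c) 1 j = ((z ^ j + w ^ j) / 2, (z ^ j - w ^ j) / (z - w))"
proof (induction j)
  case 0
  then show ?case by simp
next
  case (Suc j)
  define T U where "T = (z ^ j + w ^ j) / 2" and "U = (z ^ j - w ^ j) / (z - w)"
  have d: "z - w \<noteq> 0" using assms(3) by simp
  have c2: "c * c - 1 = (z - w)\<^sup>2 / 4"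
    unfolding c using zw by (simp add: power2_eq_square field_simps)
  have "c * T + (c * (c * U) - U) = c * T + (c * c - 1) * U"
    by (simp add: algebra_simps)
  also have "\<dots> = (z ^ Suc j + w ^ Suc j) / 2"
    unfolding c2 unfolding T_def U_def c using d by (simp add: power2_eq_square field_simps)
  finally have "c * T + (c * (c * U) - U) = (z ^ Suc j + w ^ Suc j) / 2" .
  moreover have "c * U + T = (z ^ Suc j - w ^ Suc j) / (z - w)"
    unfolding T_def U_def c using d by (simp add: field_simps)
  ultimately show ?case
    using Suc.IH by (simp add: T_def[symmetric] U_def[symmetric])
qed

lemma krylov_shift_step:
  assumes f: "linear f" and N: "\<And>x. N x = c *\<^sub>R x - \<alpha> *\<^sub>R f x"
    and y: "y - \<mu> *\<^sub>R e \<in> krylov f (f e) j"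
  shows "N y - (c * \<mu>) *\<^sub>R e \<in> krylov f (f e) (Suc j)"
proof -
  have "f (y - \<mu> *\<^sub>R e) \<in> krylov f (f e) (Suc j)"
    using krylov_image[OF f y] .
  moreover have "f e \<in> krylov f (f e) (Suc j)"
    using krylov_power[of 0 "Suc j" f "f e"] by simp
  moreover have "y - \<mu> *\<^sub>R e \<in> krylov f (f e) (Suc j)"
    using y krylov_mono[of j "Suc j"] by auto
  moreover have "N y - (c * \<mu>) *\<^sub>R e
      = c *\<^sub>R (y - \<mu> *\<^sub>R e) - \<alpha> *\<^sub>R (f (y - \<mu> *\<^sub>R e) + \<mu> *\<^sub>R f e)"
    unfolding N by (simp add: linear_diff[OF f] linear_scale[OF f] algebra_simps)
  ultimately show ?thesis
    by (simp add: subspace_krylov subspace_add subspace_diff subspace_scale)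
qed

lemma cheb_pair_krylov:
  assumes f: "linear f" and N: "\<And>x. N x = c *\<^sub>R x - \<alpha> *\<^sub>R f x"
  shows "fst (cheb_pair N e j) - fst (cheb_pair ((*) c) 1 j) *\<^sub>R e \<in> krylov f (f e) j"
proof -
  define close where "close j y \<mu> \<longleftrightarrow> y - \<mu> *\<^sub>R e \<in> krylov f (f e) j" for j y \<mu>
  have close_mono: "close (Suc j) y \<mu>" if "close j y \<mu>" for j y \<mu>
    using that krylov_mono[of j "Suc j"] unfolding close_def by auto
  have close_add: "close j (y + y') (\<mu> + \<mu>')" and close_diff: "close j (y - y') (\<mu> - \<mu>')"
    if "close j y \<mu>" "close j y' \<mu>'" for j y y' \<mu> \<mu>'
  proof -
    have "y + y' - (\<mu> + \<mu>') *\<^sub>R e = (y - \<mu> *\<^sub>R e) + (y' - \<mu>' *\<^sub>R e)"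
      and "y - y' - (\<mu> - \<mu>') *\<^sub>R e = (y - \<mu> *\<^sub>R e) - (y' - \<mu>' *\<^sub>R e)"
      by (simp_all add: algebra_simps)
    then show "close j (y + y') (\<mu> + \<mu>')" "close j (y - y') (\<mu> - \<mu>')"
      using that subspace_add[OF subspace_krylov] subspace_diff[OF subspace_krylov]
      unfolding close_def by metis+
  qed
  have close_N: "close (Suc j) (N y) (c * \<mu>)" if "close j y \<mu>" for j y \<mu>
    using krylov_shift_step[OF f N] that unfolding close_def .
  have "close j (fst (cheb_pair N e j)) (fst (cheb_pair ((*) c) 1 j))
      \<and> close j (snd (cheb_pair N e j)) (snd (cheb_pair ((*) c) 1 j))
      \<and> close j (N (snd (cheb_pair N e j))) (c * snd (cheb_pair ((*) c) 1 j))"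
  proof (induction j)
    case 0
    have "N 0 = 0" unfolding N by (simp add: linear_0[OF f])
    then show ?case by (simp add: close_def)
  next
    case (Suc j)
    obtain t u where tu: "cheb_pair N e j = (t, u)" by fastforce
    obtain \<tau> \<upsilon> where \<tau>\<upsilon>: "cheb_pair ((*) c) 1 j = (\<tau>, \<upsilon>)" by fastforce
    have t: "close j t \<tau>" and u: "close j u \<upsilon>" and Nu: "close j (N u) (c * \<upsilon>)"
      using Suc by (simp_all add: tu \<tau>\<upsilon>)
    have "N (N u + t) = N (N u) + N t"
      unfolding N by (simp add: linear_add[OF f] linear_diff[OF f] linear_scale[OF f] algebra_simps)
    moreover have "close (Suc j) (N t + (N (N u) - u)) (c * \<tau> + (c * (c * \<upsilon>) - \<upsilon>))"
      by (intro close_add close_diff close_N close_mono t u Nu)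
    moreover have "close (Suc j) (N u + t) (c * \<upsilon> + \<tau>)"
      by (intro close_add close_mono t Nu)
    moreover have "close (Suc j) (N (N u) + N t) (c * (c * \<upsilon> + \<tau>))"
      using close_add[OF close_N[OF Nu] close_N[OF t]] by (simp add: algebra_simps)
    ultimately show ?case by (simp add: tu \<tau>\<upsilon>)
  qed
  then show ?thesis unfolding close_def by simp
qed

lemma cheb_pair_scalar_growth:
  fixes q :: real
  assumes "0 < q" and "q < 1"
  shows "0 < fst (cheb_pair ((*) ((1 / q + q) / 2)) 1 m)"
    and "1 / fst (cheb_pair ((*) ((1 / q + q) / 2)) 1 m) \<le> 2 * q ^ m"
proof -
  have "q * q < 1" using assms mult_strict_mono[of q 1 q 1] by simp
  then have "1 / q * q = 1" "1 / q \<noteq> q" using assms by (auto simp: field_simps)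
  from cheb_pair_scalar[OF refl this]
  have \<tau>: "fst (cheb_pair ((*) ((1 / q + q) / 2)) 1 m) = ((1 / q) ^ m + q ^ m) / 2" by simp
  show pos: "0 < fst (cheb_pair ((*) ((1 / q + q) / 2)) 1 m)"
    unfolding \<tau> using assms by (simp add: add_pos_pos)
  have "1 / fst (cheb_pair ((*) ((1 / q + q) / 2)) 1 m) \<le> 1 / ((1 / q) ^ m / 2)"
    using pos assms unfolding \<tau> by (intro divide_left_mono) (auto simp: add_pos_nonneg)
  then show "1 / fst (cheb_pair ((*) ((1 / q + q) / 2)) 1 m) \<le> 2 * q ^ m"
    using assms by (simp add: power_one_over)
qed

lemma chebyshev_center_eq:
  fixes a b :: real
  assumes "0 < a" and "a < b"
  defines "q \<equiv> (sqrt (b / a) - 1) / (sqrt (b / a) + 1)"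
  shows "(b + a) / (b - a) = (1 / q + q) / 2" and "0 < q" and "q < 1"
proof -
  define s where "s = sqrt (b / a)"
  have s: "s > 1" "s\<^sup>2 = b / a" unfolding s_def using assms by auto
  have "s * s - 1 \<noteq> 0" using s(1) less_1_mult[of s s] by simp
  then have "(s\<^sup>2 + 1) / (s\<^sup>2 - 1) = (1 / q + q) / 2"
    unfolding q_def s_def[symmetric] using s(1) by (simp add: field_simps power2_eq_square)
  moreover have "(b + a) / (b - a) = (s\<^sup>2 + 1) / (s\<^sup>2 - 1)"
    unfolding s(2) using assms by (simp add: field_simps)
  ultimately show "(b + a) / (b - a) = (1 / q + q) / 2" by simp
  show "0 < q" "q < 1" unfolding q_def s_def[symmetric] using s by auto
qed

lemma convergence_rate_mono:
  fixes s t :: real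
  assumes "1 \<le> s" and "s \<le> t"
  shows "(s - 1) / (s + 1) \<le> (t - 1) / (t + 1)"
proof -
  have "(s - 1) * (t + 1) \<le> (t - 1) * (s + 1)" using assms by (simp add: algebra_simps)
  then show ?thesis using assms by (simp add: divide_simps)
qed

section \<open>Krylov approximation for a positive self-adjoint operator\<close>

lemma quadratic_nonpos_imp_linear_coeff_zero:
  fixes c d :: real
  assumes "\<And>t. t * c + t\<^sup>2 * d \<le> 0"
  shows "c = 0"
proof (rule ccontr)
  assume c: "c \<noteq> 0"
  define D where "D = \<bar>d\<bar> + 1"
  have D: "D > 0" "D + d > 0" unfolding D_def by linarith+
  have "(c / D) * c + (c / D)\<^sup>2 * d = c\<^sup>2 / D * ((D + d) / D)"
    using D by (simp add: power2_eq_square field_simps)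
  moreover have "(D + d) / D > 0" using D by simp
  ultimately have "(c / D) * c + (c / D)\<^sup>2 * d > 0" using c D by simp
  then show False using assms[of "c / D"] by simp
qed

locale spd_form =
  fixes G :: "real^'n^'n"
  assumes spd_G: "spd G"
begin

lemma Binner_commute: "Binner G x y = Binner G y x"
  using inner_matrix_transpose[of G y x] spd_symmetric[OF spd_G]
  by (simp add: Binner_def inner_commute)

lemma Binner_pos: "x \<noteq> 0 \<Longrightarrow> Binner G x x > 0"
  by (rule spd_pos[OF spd_G])

lemma Binner_nonneg: "Binner G x x \<ge> 0"
  by (cases "x = 0") (auto dest: Binner_pos[of x])

lemma Binner_self_eq_0_iff: "Binner G x x = 0 \<longleftrightarrow> x = 0"
  using Binner_pos by fastforce

text \<open>Polarization with \<open>y = N x\<close>: \<open>4 \<langle>N x, N x\<rangle> = \<langle>N (x + y), x + y\<rangle> - \<langle>N (x - y), x - y\<rangle>\<close>,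
  which the parallelogram law bounds by \<open>2 \<langle>x, x\<rangle> + 2 \<langle>N x, N x\<rangle>\<close>.\<close>
lemma self_adjoint_contraction:
  assumes lin: "linear N" and sa: "\<And>x y. Binner G (N x) y = Binner G x (N y)"
    and bd: "\<And>x. \<bar>Binner G (N x) x\<bar> \<le> Binner G x x"
  shows "Binner G (N x) (N x) \<le> Binner G x x"
proof -
  define y where "y = N x"
  have "Binner G (N y) x = Binner G (N x) y"
    using sa[of y x] Binner_commute[of y "N x"] by simp
  then have polar: "Binner G (N (x + y)) (x + y) - Binner G (N (x - y)) (x - y) = 4 * Binner G y y"
    using lin unfolding y_def by (simp add: linear_add linear_diff Binner_bilinear algebra_simps)
  have parallelogram: "Binner G (x + y) (x + y) + Binner G (x - y) (x - y) = 2 * Binner G x x + 2 * Binner G y y"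
    by (simp add: Binner_bilinear Binner_commute[of y x])
  have "Binner G (N (x + y)) (x + y) \<le> Binner G (x + y) (x + y)"
    and "- Binner G (N (x - y)) (x - y) \<le> Binner G (x - y) (x - y)"
    using bd[of "x + y"] bd[of "x - y"] by linarith+
  with polar parallelogram show ?thesis unfolding y_def by linarith
qed

text \<open>The operator form of the Pell identity \<open>T\<^sub>j\<^sup>2 + (1 - x\<^sup>2) U\<^sub>j\<^sub>-\<^sub>1\<^sup>2 = 1\<close>.\<close>
lemma cheb_pair_energy:
  assumes lin: "linear N" and sa: "\<And>x y. Binner G (N x) y = Binner G x (N y)"
    and "cheb_pair N e j = (t, u)"
  shows "Binner G t t + (Binner G u u - Binner G (N u) (N u)) = Binner G e e"
  using assms(3)
proof (induction j arbitrary: t u)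
  case 0
  then show ?case by (auto simp: linear_0[OF lin])
next
  case (Suc j)
  obtain t' u' where tu': "cheb_pair N e j = (t', u')" by fastforce
  have IH: "Binner G t' t' + (Binner G u' u' - Binner G (N u') (N u')) = Binner G e e"
    by (rule Suc.IH[OF tu'])
  have t: "t = N t' + (N (N u') - u')" and u: "u = N u' + t'"
    using Suc.prems tu' by auto
  have "Binner G (N t') u' = Binner G t' (N u')"
    and "Binner G u' (N t') = Binner G (N u') t'"
    and "Binner G u' (N (N u')) = Binner G (N u') (N u')"
    and "Binner G (N (N u')) u' = Binner G (N u') (N u')"
    using sa Binner_commute by metis+
  then show ?case
    unfolding t u linear_add[OF lin] using IH by (simp add: Binner_bilinear)
qed

lemma cheb_pair_bound:
  assumes lin: "linear N" and sa: "\<And>x y. Binner G (N x) y = Binner G x (N y)"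
    and bd: "\<And>x. \<bar>Binner G (N x) x\<bar> \<le> Binner G x x"
  shows "Binner G (fst (cheb_pair N e j)) (fst (cheb_pair N e j)) \<le> Binner G e e"
proof -
  obtain t u where tu: "cheb_pair N e j = (t, u)" by fastforce
  have "Binner G (N u) (N u) \<le> Binner G u u"
    by (rule self_adjoint_contraction[OF lin sa bd])
  with cheb_pair_energy[OF lin sa tu] show ?thesis by (simp add: tu)
qed

lemma rayleigh_extremal_eigenvector:
  assumes f: "linear f" and sa: "\<And>x y. Binner G (f x) y = Binner G x (f y)"
    and "\<sigma> \<noteq> 0" and extremal: "\<And>y. \<sigma> * (Binner G (f y) y - \<mu> * Binner G y y) \<le> 0"
    and attained: "Binner G (f x) x = \<mu> * Binner G x x"
  shows "f x = \<mu> *\<^sub>R x"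
proof -
  have cross: "Binner G (f x) y = \<mu> * Binner G x y" for y
  proof -
    have "Binner G (f y) x = Binner G (f x) y"
      using sa[of y x] Binner_commute[of y "f x"] by simp
    then have qf: "Binner G (f (x + t *\<^sub>R y)) (x + t *\<^sub>R y)
        = Binner G (f x) x + t * (2 * Binner G (f x) y) + t\<^sup>2 * Binner G (f y) y" for t
      by (simp add: Binner_bilinear linear_add[OF f] linear_scale[OF f] power2_eq_square algebra_simps)
    have qG: "Binner G (x + t *\<^sub>R y) (x + t *\<^sub>R y)
        = Binner G x x + t * (2 * Binner G x y) + t\<^sup>2 * Binner G y y" for t
      using Binner_commute[of y x] by (simp add: Binner_bilinear power2_eq_square algebra_simps)
    have "t * (\<sigma> * (2 * (Binner G (f x) y - \<mu> * Binner G x y)))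
        + t\<^sup>2 * (\<sigma> * (Binner G (f y) y - \<mu> * Binner G y y))
        = \<sigma> * (Binner G (f (x + t *\<^sub>R y)) (x + t *\<^sub>R y) - \<mu> * Binner G (x + t *\<^sub>R y) (x + t *\<^sub>R y))" for t
      unfolding qf qG attained by (simp add: algebra_simps)
    then have "t * (\<sigma> * (2 * (Binner G (f x) y - \<mu> * Binner G x y)))
        + t\<^sup>2 * (\<sigma> * (Binner G (f y) y - \<mu> * Binner G y y)) \<le> 0" for t
      using extremal by presburger
    then show ?thesis
      using quadratic_nonpos_imp_linear_coeff_zero \<open>\<sigma> \<noteq> 0\<close> by fastforce
  qed
  have "Binner G (f x - \<mu> *\<^sub>R x) (f x - \<mu> *\<^sub>R x) = 0"
    using cross by (simp add: Binner_diff_left Binner_scaleR_left)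
  then show ?thesis by (simp add: Binner_self_eq_0_iff)
qed

lemma rayleigh_quotient_extrema:
  obtains x y where "x \<noteq> 0" and "y \<noteq> 0"
    and "\<And>z. Binner G (M *v x) x / Binner G x x * Binner G z z \<le> Binner G (M *v z) z"
    and "\<And>z. Binner G (M *v z) z \<le> Binner G (M *v y) y / Binner G y y * Binner G z z"
proof -
  define R where "R x = Binner G (M *v x) x / Binner G x x" for x
  define S where "S = sphere (0::real^'n) 1"
  have S: "compact S" "S \<noteq> {}" unfolding S_def by auto
  have "Binner G x x \<noteq> 0" if "x \<in> S" for x
    using that Binner_self_eq_0_iff[of x] by (auto simp: S_def)
  then have "continuous_on S R"
    unfolding R_def Binner_def by (intro continuous_intros) auto
  then obtain xa xb where xa: "xa \<in> S" "\<And>y. y \<in> S \<Longrightarrow> R xa \<le> R y"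
    and xb: "xb \<in> S" "\<And>y. y \<in> S \<Longrightarrow> R y \<le> R xb"
    using continuous_attains_inf[OF S] continuous_attains_sup[OF S] by blast
  have R_normalize: "R ((1 / norm z) *\<^sub>R z) = R z" for z
    unfolding R_def by (simp add: Binner_bilinear matrix_vector_mult_scaleR)
  have "R xa * Binner G z z \<le> Binner G (M *v z) z \<and> Binner G (M *v z) z \<le> R xb * Binner G z z" for z
  proof (cases "z = 0")
    case False
    then have "(1 / norm z) *\<^sub>R z \<in> S" unfolding S_def by simp
    then have "R xa \<le> R z" "R z \<le> R xb"
      using xa(2) xb(2) R_normalize[of z] by fastforce+
    then show ?thesis
      unfolding R_def using Binner_pos[OF False] by (simp add: field_simps)
  qed simp
  moreover have "xa \<noteq> 0" "xb \<noteq> 0" using xa(1) xb(1) unfolding S_def by auto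
  ultimately show ?thesis using that unfolding R_def by blast
qed

lemma rayleigh_bounds:
  assumes sa: "\<And>x y. Binner G (M *v x) y = Binner G x (M *v y)"
    and pos: "\<And>x. x \<noteq> 0 \<Longrightarrow> Binner G (M *v x) x > 0"
  obtains a b where "0 < a" and "a \<le> b" and "b / a \<le> cond2 M"
    and "\<And>x. a * Binner G x x \<le> Binner G (M *v x) x"
    and "\<And>x. Binner G (M *v x) x \<le> b * Binner G x x"
proof -
  obtain xa xb where nz: "xa \<noteq> 0" "xb \<noteq> 0"
    and lower: "\<And>z. Binner G (M *v xa) xa / Binner G xa xa * Binner G z z \<le> Binner G (M *v z) z"
    and upper: "\<And>z. Binner G (M *v z) z \<le> Binner G (M *v xb) xb / Binner G xb xb * Binner G z z"
    using rayleigh_quotient_extrema[where M = M] by blast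
  define a b where "a = Binner G (M *v xa) xa / Binner G xa xa"
    and "b = Binner G (M *v xb) xb / Binner G xb xb"
  have lower': "a * Binner G z z \<le> Binner G (M *v z) z"
    and upper': "Binner G (M *v z) z \<le> b * Binner G z z" for z
    unfolding a_def b_def using lower upper by blast+
  have a: "0 < a" unfolding a_def using pos[OF nz(1)] Binner_pos[OF nz(1)] by simp
  have attained: "Binner G (M *v xa) xa = a * Binner G xa xa" "Binner G (M *v xb) xb = b * Binner G xb xb"
    unfolding a_def b_def using Binner_pos[OF nz(1)] Binner_pos[OF nz(2)] by simp_all
  have "a \<le> b" using lower'[of xb] attained(2) Binner_pos[OF nz(2)] by simp
  have Ma: "M *v xa = a *\<^sub>R xa"
    by (rule rayleigh_extremal_eigenvector[OF matrix_vector_mul_linear sa, of "-1"])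
      (use lower' attained(1) in \<open>simp_all add: right_diff_distrib\<close>)
  have Mb: "M *v xb = b *\<^sub>R xb"
    by (rule rayleigh_extremal_eigenvector[OF matrix_vector_mul_linear sa, of 1])
      (use upper' attained(2) in \<open>simp_all add: right_diff_distrib\<close>)
  have "x = 0" if "M *v x = 0" for x
    using pos[of x] that by fastforce
  then have "invertible M"
    using matrix_left_invertible_ker invertible_left_inverse by blast
  then have "a *\<^sub>R (matrix_inv M *v xa) = xa"
    using matrix_vector_mul_inv_left[of M xa] Ma by (simp add: matrix_vector_mult_scaleR)
  then have "matrix_inv M *v xa = (1 / a) *\<^sub>R xa"
    using a by (metis scaleR_scaleR nonzero_divide_eq_eq scaleR_one less_irrefl)
  from eigenvalue_le_opnorm2[OF this nz(1)] have "1 / a \<le> opnorm2 (matrix_inv M)"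
    using a by simp
  moreover have "b \<le> opnorm2 M"
    using eigenvalue_le_opnorm2[OF Mb nz(2)] by simp
  ultimately have "b * (1 / a) \<le> cond2 M"
    unfolding cond2_def using a \<open>a \<le> b\<close> by (intro mult_mono) auto
  then show ?thesis
    using that[OF a \<open>a \<le> b\<close> _ lower' upper'] by simp
qed

lemma rescaled_operator_bound:
  assumes ab: "0 < a" "a < b"
    and lower: "\<And>x. a * Binner G x x \<le> Binner G (f x) x"
    and upper: "\<And>x. Binner G (f x) x \<le> b * Binner G x x"
  shows "\<bar>Binner G (((b + a) / (b - a)) *\<^sub>R x - (2 / (b - a)) *\<^sub>R f x) x\<bar> \<le> Binner G x x"
proof -
  define c \<alpha> where "c = (b + a) / (b - a)" and "\<alpha> = 2 / (b - a)"
  have "c - \<alpha> * a = 1" "c - \<alpha> * b = -1"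
    unfolding c_def \<alpha>_def using ab by (simp_all add: divide_simps)
  moreover have "\<alpha> > 0" unfolding \<alpha>_def using ab by simp
  then have "\<alpha> * (a * Binner G x x) \<le> \<alpha> * Binner G (f x) x"
    and "\<alpha> * Binner G (f x) x \<le> \<alpha> * (b * Binner G x x)"
    using lower upper by (simp_all add: mult_left_mono)
  moreover have "Binner G (c *\<^sub>R x - \<alpha> *\<^sub>R f x) x = c * Binner G x x - \<alpha> * Binner G (f x) x"
    by (simp add: Binner_bilinear)
  ultimately have "(c - \<alpha> * b) * Binner G x x \<le> Binner G (c *\<^sub>R x - \<alpha> *\<^sub>R f x) x"
    and "Binner G (c *\<^sub>R x - \<alpha> *\<^sub>R f x) x \<le> (c - \<alpha> * a) * Binner G x x"
    by (simp_all add: algebra_simps)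
  with \<open>c - \<alpha> * a = 1\<close> \<open>c - \<alpha> * b = -1\<close> show ?thesis
    unfolding c_def \<alpha>_def by simp
qed

text \<open>The witness is \<open>e + w = T\<^sub>m(N) e / T\<^sub>m(c)\<close>, where \<open>N = c - \<alpha> f\<close> maps the
  spectral interval \<open>[a, b]\<close> onto \<open>[-1, 1]\<close>.\<close>
lemma chebyshev_krylov_bound:
  assumes f: "linear f" and sa: "\<And>x y. Binner G (f x) y = Binner G x (f y)"
    and ab: "0 < a" "a < b"
    and lower: "\<And>x. a * Binner G x x \<le> Binner G (f x) x"
    and upper: "\<And>x. Binner G (f x) x \<le> b * Binner G x x"
  defines "q \<equiv> (sqrt (b / a) - 1) / (sqrt (b / a) + 1)"
  obtains w where "w \<in> krylov f (f e) m"
    and "Binner G (e + w) (e + w) \<le> (2 * q ^ m)\<^sup>2 * Binner G e e"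
proof -
  define c \<alpha> where "c = (b + a) / (b - a)" and "\<alpha> = 2 / (b - a)"
  have c: "c = (1 / q + q) / 2" and q: "0 < q" "q < 1"
    unfolding c_def q_def by (rule chebyshev_center_eq[OF ab])+
  define N where "N x = c *\<^sub>R x - \<alpha> *\<^sub>R f x" for x
  have N_linear: "linear N"
    unfolding N_def[abs_def] by (intro linear_compose_sub linear_compose_scale_right f linear_scaleR)
  have N_sa: "Binner G (N x) y = Binner G x (N y)" for x y
    unfolding N_def using sa[of x y] by (simp add: Binner_bilinear)
  have N_bound: "\<bar>Binner G (N x) x\<bar> \<le> Binner G x x" for x
    unfolding N_def c_def \<alpha>_def by (rule rescaled_operator_bound[OF ab lower upper])
  define T \<tau> where "T = fst (cheb_pair N e m)" and "\<tau> = fst (cheb_pair ((*) c) 1 m)"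
  have \<tau>: "0 < \<tau>" "1 / \<tau> \<le> 2 * q ^ m"
    unfolding \<tau>_def c by (rule cheb_pair_scalar_growth[OF q])+
  have "(1 / \<tau>) *\<^sub>R (T - \<tau> *\<^sub>R e) \<in> krylov f (f e) m"
    unfolding T_def \<tau>_def
    by (intro subspace_scale[OF subspace_krylov] cheb_pair_krylov[OF f, of N c \<alpha>]) (simp add: N_def)
  moreover have "e + (1 / \<tau>) *\<^sub>R (T - \<tau> *\<^sub>R e) = (1 / \<tau>) *\<^sub>R T"
    using \<tau> by (simp add: scaleR_diff_right)
  moreover have "Binner G ((1 / \<tau>) *\<^sub>R T) ((1 / \<tau>) *\<^sub>R T) = (1 / \<tau>)\<^sup>2 * Binner G T T"
    by (simp add: Binner_bilinear power2_eq_square)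
  moreover have "(1 / \<tau>)\<^sup>2 * Binner G T T \<le> (2 * q ^ m)\<^sup>2 * Binner G e e"
    using cheb_pair_bound[OF N_linear N_sa N_bound, of e m] \<tau> Binner_nonneg[of T]
    unfolding T_def by (intro mult_mono power_mono) auto
  ultimately show ?thesis
    using that by metis
qed

lemma krylov_rayleigh_bound:
  assumes f: "linear f" and sa: "\<And>x y. Binner G (f x) y = Binner G x (f y)"
    and ab: "0 < a" "a \<le> b"
    and lower: "\<And>x. a * Binner G x x \<le> Binner G (f x) x"
    and upper: "\<And>x. Binner G (f x) x \<le> b * Binner G x x"
  defines "q \<equiv> (sqrt (b / a) - 1) / (sqrt (b / a) + 1)"
  obtains w where "w \<in> krylov f (f e) m"
    and "Binner G (e + w) (e + w) \<le> (2 * q ^ m)\<^sup>2 * Binner G e e"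
proof (cases "a = b")
  case True
  have eig: "f x = a *\<^sub>R x" for x
  proof (rule rayleigh_extremal_eigenvector[OF f sa, of 1])
    show "1 * (Binner G (f y) y - a * Binner G y y) \<le> 0" for y
      using upper[of y] True by simp
    show "Binner G (f x) x = a * Binner G x x"
      using lower[of x] upper[of x] True by (intro antisym) simp_all
  qed simp
  show ?thesis
  proof (cases "m = 0")
    case True
    have "Binner G (e + 0) (e + 0) \<le> (2 * q ^ m)\<^sup>2 * Binner G e e"
      using Binner_nonneg[of e] True by simp
    then show ?thesis using that[of 0] True by simp
  next
    case False
    have "f e \<in> krylov f (f e) m" using krylov_power[of 0 m f "f e"] False by simp
    then have "(- 1 / a) *\<^sub>R f e \<in> krylov f (f e) m" by (rule subspace_scale[OF subspace_krylov])
    moreover have "e + (- 1 / a) *\<^sub>R f e = 0" using eig[of e] ab(1) by simp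
    ultimately show ?thesis
      using that[of "(- 1 / a) *\<^sub>R f e"] Binner_nonneg[of e] by simp
  qed
next
  case False
  then have "a < b" using ab(2) by simp
  from chebyshev_krylov_bound[OF f sa ab(1) this lower upper] that show ?thesis
    unfolding q_def by blast
qed

lemma krylov_cond2_bound:
  assumes sa: "\<And>x y. Binner G (M *v x) y = Binner G x (M *v y)"
    and pos: "\<And>x. x \<noteq> 0 \<Longrightarrow> Binner G (M *v x) x > 0"
  obtains w where "w \<in> krylov ((*v) M) (M *v e) m"
    and "Bnorm G (e + w) \<le> 2 * ((sqrt (cond2 M) - 1) / (sqrt (cond2 M) + 1)) ^ m * Bnorm G e"
proof -
  obtain a b where ab: "0 < a" "a \<le> b" "b / a \<le> cond2 M"
    and lower: "\<And>x. a * Binner G x x \<le> Binner G (M *v x) x"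
    and upper: "\<And>x. Binner G (M *v x) x \<le> b * Binner G x x"
    using rayleigh_bounds[OF sa pos] by blast
  define q \<rho> where "q = (sqrt (b / a) - 1) / (sqrt (b / a) + 1)"
    and "\<rho> = (sqrt (cond2 M) - 1) / (sqrt (cond2 M) + 1)"
  obtain w where w: "w \<in> krylov ((*v) M) (M *v e) m"
    and bound: "Binner G (e + w) (e + w) \<le> (2 * q ^ m)\<^sup>2 * Binner G e e"
    using krylov_rayleigh_bound[OF matrix_vector_mul_linear sa ab(1,2) lower upper]
    unfolding q_def by blast
  have rate: "1 \<le> sqrt (b / a)" "sqrt (b / a) \<le> sqrt (cond2 M)"
    using ab by auto
  then have q: "0 \<le> q" "q \<le> \<rho>"
    unfolding q_def \<rho>_def using convergence_rate_mono[OF rate] by simp_all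
  have "Bnorm G (e + w) \<le> sqrt ((2 * q ^ m)\<^sup>2 * Binner G e e)"
    unfolding Bnorm_Binner using bound by (rule real_sqrt_le_mono)
  also have "\<dots> = 2 * q ^ m * Bnorm G e"
    using q by (simp add: Bnorm_Binner real_sqrt_mult)
  also have "\<dots> \<le> 2 * \<rho> ^ m * Bnorm G e"
    using q by (intro mult_right_mono mult_left_mono power_mono) (auto simp: Bnorm_Binner Binner_nonneg)
  finally show ?thesis using that w unfolding \<rho>_def by blast
qed

end

section \<open>The BayesCG iteration\<close>

lemma kinv_identity:
  assumes "\<forall>i<k. \<forall>j<k. Lam i j = (if i = j then 1 else 0)"
  shows "kinv k Lam = (\<lambda>i j. if i < k \<and> i = j then 1 else 0)"
  unfolding kinv_def
proof (rule the_equality)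
  have "(\<Sum>l<k. (if i < k \<and> i = l then 1 else 0) * Lam l j) = Lam i j"
    and "(\<Sum>l<k. Lam i l * (if l < k \<and> l = j then 1 else 0)) = Lam i j"
    if "i < k" "j < k" for i j
    using that by (simp_all add: if_distrib if_distribR sum.delta sum.delta' cong: if_cong)
  then show "(\<forall>i j. (k \<le> i \<or> k \<le> j) \<longrightarrow> (if i < k \<and> i = j then 1 else 0) = (0::real)) \<and>
    (\<forall>i<k. \<forall>j<k. kmult k (\<lambda>i j. if i < k \<and> i = j then 1 else 0) Lam i j = (if i = j then 1 else 0)) \<and>
    (\<forall>i<k. \<forall>j<k. kmult k Lam (\<lambda>i j. if i < k \<and> i = j then 1 else 0) i j = (if i = j then 1 else 0))"
    using assms unfolding kmult_def by auto
next
  fix N assume N: "(\<forall>i j. (k \<le> i \<or> k \<le> j) \<longrightarrow> N i j = 0) \<and>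
    (\<forall>i<k. \<forall>j<k. kmult k N Lam i j = (if i = j then 1 else 0)) \<and>
    (\<forall>i<k. \<forall>j<k. kmult k Lam N i j = (if i = j then 1 else 0))"
  show "N = (\<lambda>i j. if i < k \<and> i = j then 1 else 0)"
  proof (intro ext)
    fix i j
    show "N i j = (if i < k \<and> i = j then 1 else 0)"
    proof (cases "i < k \<and> j < k")
      case True
      have "kmult k N Lam i j = (\<Sum>l<k. if l = j then N i j else 0)"
        unfolding kmult_def by (rule sum.cong) (use assms True in auto)
      then have "kmult k N Lam i j = N i j"
        using True by simp
      then show ?thesis using N True by auto
    next
      case False
      then show ?thesis using N by auto
    qed
  qed
qed

lemma length_bcg_stildes: "length (bcg_stildes A Sig b x0 k) = k"
  by (induction k) (simp_all add: Let_def)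

lemma bcg_stildes_prefix:
  "k \<le> k' \<Longrightarrow> bcg_stildes A Sig b x0 k = take k (bcg_stildes A Sig b x0 k')"
proof (induction k')
  case (Suc k')
  then show ?case
    by (cases "k = Suc k'") (simp_all add: Let_def length_bcg_stildes)
qed simp

locale bayescg =
  fixes A Sig :: "real^'n^'n" and b x0 :: "real^'n"
  assumes invertible_A: "invertible A" and spd_Sig: "spd Sig"
begin

text \<open>\<open>dirs k\<close> lists the paper's \<open>s\<^sub>1, \<dots>, s\<^sub>k\<close> at indices \<open>0, \<dots>, k - 1\<close>, and
  \<open>next_dir k\<close> is the unnormalised direction of step \<open>k + 1\<close>.  Once the directions are
  \<open>B\<close>-orthonormal, \<open>\<Lambda>\<^sub>k\<close> is the identity and \<open>proj k = S\<^sub>k S\<^sub>k\<^sup>T r\<^sub>0\<close>.\<close>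

definition B :: "real^'n^'n" where "B = A ** Sig ** transpose A"
definition r0 :: "real^'n" where "r0 = b - A *v x0"
definition dirs :: "nat \<Rightarrow> (real^'n) list" where "dirs k = bcg_dirs A Sig b x0 k"
definition resid :: "nat \<Rightarrow> real^'n" where "resid k = b - A *v bcg_x A Sig b x0 k"
definition next_dir :: "nat \<Rightarrow> real^'n" where
  "next_dir k = (if k = 0 then resid k
     else resid k - Binner B (last (dirs k)) (resid k) *\<^sub>R last (dirs k))"
definition proj :: "nat \<Rightarrow> real^'n" where
  "proj k = (\<Sum>i<k. (dirs k ! i \<bullet> r0) *\<^sub>R dirs k ! i)"
definition B_orthonormal :: "nat \<Rightarrow> bool" where
  "B_orthonormal k \<longleftrightarrow>
     (\<forall>i<k. \<forall>j<k. Binner B (dirs k ! i) (dirs k ! j) = (if i = j then 1 else 0))"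

abbreviation dir_span :: "nat \<Rightarrow> (real^'n) set" where
  "dir_span k \<equiv> span (set (dirs k))"

abbreviation residual_krylov :: "nat \<Rightarrow> (real^'n) set" where
  "residual_krylov k \<equiv> krylov ((*v) B) r0 k"

sublocale B: spd_form B
  unfolding B_def by unfold_locales (rule spd_congruence[OF invertible_A spd_Sig])

lemma A_Sig_At_eq_B: "A *v ((Sig ** transpose A) *v v) = B *v v"
  by (simp add: B_def matrix_vector_mul_assoc matrix_mul_assoc)

lemma bcg_stildes_Suc: "bcg_stildes A Sig b x0 (Suc k) = bcg_stildes A Sig b x0 k @ [next_dir k]"
  by (simp add: Let_def next_dir_def resid_def bcg_x_def dirs_def bcg_dirs_def B_def)

lemma length_dirs [simp]: "length (dirs k) = k"
  by (simp add: dirs_def bcg_dirs_def length_bcg_stildes)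

lemma dirs_Suc: "dirs (Suc k) = dirs k @ [(1 / Bnorm B (next_dir k)) *\<^sub>R next_dir k]"
  unfolding dirs_def bcg_dirs_def bcg_stildes_Suc by (simp add: B_def)

lemma dirs_nth_Suc: "i < Suc k \<Longrightarrow>
    dirs (Suc k) ! i = (if i < k then dirs k ! i else (1 / Bnorm B (next_dir k)) *\<^sub>R next_dir k)"
  by (simp add: dirs_Suc nth_append)

lemma dirs_prefix: "k \<le> k' \<Longrightarrow> i < k \<Longrightarrow> dirs k' ! i = dirs k ! i"
  using bcg_stildes_prefix[of k k' A Sig b x0]
  by (simp add: dirs_def bcg_dirs_def length_bcg_stildes)

lemma dir_in_dir_span: "i < k \<Longrightarrow> dirs k ! i \<in> dir_span k"
  by (simp add: span_base)

lemma dir_span_mono: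
  assumes "k \<le> k'" shows "dir_span k \<subseteq> dir_span k'"
proof (rule span_mono, rule subsetI)
  fix v assume "v \<in> set (dirs k)"
  then obtain i where i: "i < k" "v = dirs k ! i" by (auto simp: in_set_conv_nth)
  have "dirs k' ! i \<in> set (dirs k')" using i assms by (intro nth_mem) simp
  then show "v \<in> set (dirs k')" using dirs_prefix[OF assms i(1)] i by simp
qed

lemma proj_in_dir_span: "proj k \<in> dir_span k"
  unfolding proj_def by (intro span_sum span_scale span_base) simp

lemma bcg_x_eq:
  assumes "B_orthonormal k"
  shows "bcg_x A Sig b x0 k = x0 + (Sig ** transpose A) *v proj k"
proof -
  define Lam where "Lam i j = dirs k ! i \<bullet> (B *v dirs k ! j)" for i j
  have "kinv k Lam = (\<lambda>i j. if i < k \<and> i = j then 1 else 0)"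
    by (rule kinv_identity) (use assms in \<open>simp add: B_orthonormal_def Lam_def Binner_def\<close>)
  then have "(\<Sum>j<k. kinv k Lam i j * (dirs k ! j \<bullet> r0)) = dirs k ! i \<bullet> r0" if "i < k" for i
    using that by (simp add: if_distrib if_distribR sum.delta' cong: if_cong)
  then show ?thesis
    unfolding bcg_x_def bcg_mean_def Let_def proj_def
    by (simp add: dirs_def[symmetric] B_def[symmetric] r0_def[symmetric] Lam_def[abs_def])
qed

lemma resid_eq: "B_orthonormal k \<Longrightarrow> resid k = r0 - B *v proj k"
  by (simp add: resid_def r0_def bcg_x_eq matrix_vector_right_distrib A_Sig_At_eq_B)

lemma resid_orthogonal:
  assumes "B_orthonormal k" and "v \<in> dir_span k"
  shows "v \<bullet> resid k = 0"
proof -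
  have "v \<bullet> resid k = 0" if "v \<in> set (dirs k)" for v
  proof -
    obtain l where l: "l < k" "v = dirs k ! l" using \<open>v \<in> set (dirs k)\<close> by (auto simp: in_set_conv_nth)
    have "v \<bullet> (B *v proj k) = (\<Sum>i<k. (dirs k ! i \<bullet> r0) * Binner B v (dirs k ! i))"
      unfolding proj_def
      by (simp add: linear_sum[OF matrix_vector_mul_linear] inner_sum_right matrix_vector_mult_scaleR
          Binner_def)
    also have "\<dots> = (\<Sum>i<k. if i = l then v \<bullet> r0 else 0)"
      by (rule sum.cong) (use assms(1) l in \<open>auto simp: B_orthonormal_def\<close>)
    also have "\<dots> = v \<bullet> r0"
      using l by simp
    finally show ?thesis using resid_eq[OF assms(1)] by (simp add: inner_diff_right)
  qed
  moreover have "subspace {v. v \<bullet> resid k = 0}"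
    by (auto simp: subspace_def inner_add_left)
  ultimately show ?thesis
    using span_induct[OF assms(2), of "\<lambda>v. v \<bullet> resid k = 0"] by blast
qed

lemma Binner_B_eq: "Binner B x y = (B *v x) \<bullet> y"
  using B.Binner_commute[of x y] by (simp add: Binner_def inner_commute)

lemma last_dirs: "0 < k \<Longrightarrow> last (dirs k) = dirs k ! (k - 1)"
  by (metis last_conv_nth length_dirs length_0_conv less_irrefl)

text \<open>The short recurrence suffices: for \<open>l < k - 1\<close> the vector \<open>B s\<^sub>l\<close> lies in
  \<open>K\<^sub>l\<^sub>+\<^sub>2 \<subseteq> K\<^sub>k\<close>, the span of \<open>s\<^sub>1, \<dots>, s\<^sub>k\<close>, to which the residual is orthogonal.\<close>
lemma next_dir_B_orthogonal:
  assumes ON: "B_orthonormal k" and span: "\<And>j. j \<le> k \<Longrightarrow> dir_span j = residual_krylov j"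
    and "l < k"
  shows "Binner B (dirs k ! l) (next_dir k) = 0"
proof -
  define s c where "s = dirs k ! (k - 1)" and "c = Binner B s (resid k)"
  have next_dir: "next_dir k = resid k - c *\<^sub>R s"
    using \<open>l < k\<close> by (simp add: next_dir_def last_dirs s_def c_def)
  have ON_s: "Binner B (dirs k ! l) s = (if l = k - 1 then 1 else 0)"
    using ON \<open>l < k\<close> by (simp add: B_orthonormal_def s_def)
  show ?thesis
  proof (cases "l = k - 1")
    case True
    then show ?thesis using ON_s by (simp add: next_dir Binner_bilinear s_def c_def)
  next
    case False
    then have "Suc (Suc l) \<le> k" using \<open>l < k\<close> by simp
    have "dirs k ! l \<in> residual_krylov (Suc l)"
      using dirs_prefix[of "Suc l" k l] dir_in_dir_span[of l "Suc l"] span[of "Suc l"] \<open>l < k\<close> by simp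
    then have "B *v dirs k ! l \<in> residual_krylov k"
      using krylov_image[OF matrix_vector_mul_linear] krylov_mono[OF \<open>Suc (Suc l) \<le> k\<close>] by blast
    then have "Binner B (dirs k ! l) (resid k) = 0"
      using resid_orthogonal[OF ON] span[of k] by (simp add: Binner_B_eq)
    then show ?thesis using ON_s False by (simp add: next_dir Binner_bilinear)
  qed
qed

lemma dir_span_Suc_subset:
  assumes ON: "B_orthonormal k" and span: "dir_span k = residual_krylov k"
  shows "dir_span (Suc k) \<subseteq> residual_krylov (Suc k)"
proof -
  have old: "dir_span k \<subseteq> residual_krylov (Suc k)"
    using span krylov_mono[of k "Suc k"] by simp
  have "r0 \<in> residual_krylov (Suc k)"
    using krylov_power[of 0 "Suc k" "(*v) B" r0] by simp
  moreover have "B *v proj k \<in> residual_krylov (Suc k)"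
    using krylov_image[OF matrix_vector_mul_linear] proj_in_dir_span span by blast
  ultimately have "resid k \<in> residual_krylov (Suc k)"
    using resid_eq[OF ON] by (simp add: subspace_diff[OF subspace_krylov])
  moreover have "last (dirs k) \<in> residual_krylov (Suc k)" if "0 < k"
    using old dir_in_dir_span[of "k - 1" k] that by (auto simp: last_dirs)
  ultimately have "next_dir k \<in> residual_krylov (Suc k)"
    by (cases "k = 0")
      (simp_all add: next_dir_def subspace_diff[OF subspace_krylov] subspace_scale[OF subspace_krylov])
  then have "set (dirs (Suc k)) \<subseteq> residual_krylov (Suc k)"
    using old span_superset[of "set (dirs k)"]
    by (auto simp: dirs_Suc subspace_scale[OF subspace_krylov])
  then show ?thesis
    by (rule span_minimal[OF _ subspace_krylov])
qed

sublocale Sig_inv: spd_form "matrix_inv Sig"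
  by unfold_locales (rule spd_matrix_inv[OF spd_Sig])

definition x_star :: "real^'n" where "x_star = matrix_inv A *v b"
definition M :: "real^'n^'n" where "M = Sig ** transpose A ** A"

lemma Binner_inv_Sig_adjoint: "Binner (matrix_inv Sig) ((Sig ** transpose A) *v v) y = v \<bullet> (A *v y)"
proof -
  have "Binner (matrix_inv Sig) ((Sig ** transpose A) *v v) y
      = y \<bullet> (matrix_inv Sig *v (Sig *v (transpose A *v v)))"
    using Sig_inv.Binner_commute
    by (simp add: Binner_def matrix_vector_mul_assoc del: transpose_matrix_vector)
  also have "\<dots> = (A *v y) \<bullet> v"
    by (simp add: matrix_vector_mul_inv_left[OF spd_invertible[OF spd_Sig]] inner_matrix_transpose
        del: transpose_matrix_vector)
  finally show ?thesis by (simp add: inner_commute)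
qed

lemma M_eq: "M *v x = (Sig ** transpose A) *v (A *v x)"
  by (simp add: M_def matrix_vector_mul_assoc)

lemma Binner_inv_Sig_M: "Binner (matrix_inv Sig) (M *v x) y = (A *v x) \<bullet> (A *v y)"
  by (simp add: M_eq Binner_inv_Sig_adjoint)

lemma M_self_adjoint: "Binner (matrix_inv Sig) (M *v x) y = Binner (matrix_inv Sig) x (M *v y)"
  using Sig_inv.Binner_commute[of x] by (simp add: Binner_inv_Sig_M inner_commute)

lemma M_positive: "x \<noteq> 0 \<Longrightarrow> Binner (matrix_inv Sig) (M *v x) x > 0"
  using matrix_vector_mul_inv_left[OF invertible_A, of x] by (auto simp: Binner_inv_Sig_M)

lemma M_power_error:
  "(((*v) M) ^^ i) (M *v (x0 - x_star)) = - ((Sig ** transpose A) *v ((((*v) B) ^^ i) r0))"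
proof (induction i)
  case 0
  have "A *v (x0 - x_star) = - r0"
    by (simp add: x_star_def r0_def matrix_vector_mult_diff_distrib
        matrix_vector_mul_inv_right[OF invertible_A])
  then show ?case by (simp add: M_eq linear_neg[OF matrix_vector_mul_linear])
next
  case (Suc i)
  then show ?case by (simp add: M_eq A_Sig_At_eq_B linear_neg[OF matrix_vector_mul_linear])
qed

end

locale bayescg_nonbreaking = bayescg +
  fixes m :: nat
  assumes bcg_stilde_nonzero: "\<forall>k\<in>{1..m}. bcg_stilde A Sig b x0 k \<noteq> 0"
begin

lemma next_dir_nonzero: "k < m \<Longrightarrow> next_dir k \<noteq> 0"
  using bcg_stilde_nonzero[rule_format, of "Suc k"]
  unfolding bcg_stilde_def bcg_stildes_Suc by (simp add: nth_append length_bcg_stildes)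

lemma B_orthonormal_Suc:
  assumes "k < m" and ON: "B_orthonormal k"
    and span: "\<And>j. j \<le> k \<Longrightarrow> dir_span j = residual_krylov j"
  shows "B_orthonormal (Suc k)"
proof -
  define s where "s = (1 / Bnorm B (next_dir k)) *\<^sub>R next_dir k"
  have pos: "Binner B (next_dir k) (next_dir k) > 0"
    using B.Binner_pos next_dir_nonzero[OF \<open>k < m\<close>] by blast
  then have unit: "Binner B s s = 1"
    unfolding s_def by (simp add: Binner_bilinear Bnorm_Binner)
  have orth: "Binner B (dirs k ! i) s = 0" if "i < k" for i
    using next_dir_B_orthogonal[OF ON span that] by (simp add: s_def Binner_bilinear)
  then have orth': "Binner B s (dirs k ! i) = 0" if "i < k" for i
    using that B.Binner_commute by metis
  show ?thesis
    unfolding B_orthonormal_def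
    using ON unit orth orth' by (auto simp: B_orthonormal_def dirs_nth_Suc s_def[symmetric] less_Suc_eq)
qed

lemma resid_in_dir_span_Suc:
  assumes "k < m"
  shows "resid k \<in> dir_span (Suc k)"
proof -
  have old: "dir_span k \<subseteq> dir_span (Suc k)" by (rule dir_span_mono) simp
  have "Bnorm B (next_dir k) \<noteq> 0"
    using B.Binner_pos[OF next_dir_nonzero[OF assms]] by (simp add: Bnorm_Binner)
  moreover have "(1 / Bnorm B (next_dir k)) *\<^sub>R next_dir k \<in> dir_span (Suc k)"
    using dir_in_dir_span[of k "Suc k"] by (simp add: dirs_nth_Suc)
  ultimately have "next_dir k \<in> dir_span (Suc k)"
    using span_scale[of _ _ "Bnorm B (next_dir k)"] by fastforce
  moreover have "last (dirs k) \<in> dir_span (Suc k)" if "0 < k"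
    using old dir_in_dir_span[of "k - 1" k] that by (auto simp: last_dirs)
  ultimately show ?thesis
    by (cases "k = 0") (auto simp: next_dir_def intro: span_add span_scale
        dest: span_add[of _ _ "Binner B (last (dirs k)) (resid k) *\<^sub>R last (dirs k)"])
qed

text \<open>Writing \<open>proj k = \<gamma> B\<^sup>k\<^sup>-\<^sup>1 r\<^sub>0 + v\<close> with \<open>v \<in> K\<^sub>k\<^sub>-\<^sub>1\<close> gives
  \<open>resid k = (r\<^sub>0 - B v) - \<gamma> B\<^sup>k r\<^sub>0\<close>; here \<open>\<gamma> \<noteq> 0\<close>, for otherwise the residual would lie
  in \<open>K\<^sub>k\<close> and hence be orthogonal to itself.\<close>
lemma krylov_power_in_dir_span_Suc:
  assumes "k < m" and ON: "B_orthonormal k" and span: "dir_span k = residual_krylov k"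
  shows "(((*v) B) ^^ k) r0 \<in> dir_span (Suc k)"
proof (cases k)
  case 0
  then show ?thesis
    using resid_in_dir_span_Suc[OF \<open>k < m\<close>] resid_eq[OF ON] by (simp add: proj_def)
next
  case (Suc k')
  have "proj k \<in> span (insert ((((*v) B) ^^ k') r0) (residual_krylov k'))"
    using proj_in_dir_span[of k] span by (simp add: Suc krylov_Suc)
  then obtain \<gamma> where v: "proj k - \<gamma> *\<^sub>R (((*v) B) ^^ k') r0 \<in> residual_krylov k'"
    by (auto simp: span_breakdown_eq span_eq_iff[THEN iffD2, OF subspace_krylov])
  define v where "v = proj k - \<gamma> *\<^sub>R (((*v) B) ^^ k') r0"
  have "B *v v \<in> residual_krylov k"
    using krylov_image[OF matrix_vector_mul_linear v] by (simp add: v_def Suc)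
  moreover have "r0 \<in> residual_krylov k"
    using krylov_power[of 0 k "(*v) B" r0] Suc by simp
  ultimately have rest: "r0 - B *v v \<in> dir_span k"
    using span by (simp add: subspace_diff[OF subspace_krylov])
  have "(((*v) B) ^^ k) r0 = B *v ((((*v) B) ^^ k') r0)" by (simp add: Suc)
  then have resid_split: "resid k = (r0 - B *v v) - \<gamma> *\<^sub>R (((*v) B) ^^ k) r0"
    by (simp add: resid_eq[OF ON] v_def matrix_vector_mult_diff_distrib matrix_vector_mult_scaleR)
  have "\<gamma> \<noteq> 0"
  proof
    assume "\<gamma> = 0"
    then have "resid k \<bullet> resid k = 0"
      using resid_orthogonal[OF ON] rest resid_split by simp
    then have "next_dir k = 0" by (simp add: next_dir_def Suc)
    then show False using next_dir_nonzero[OF \<open>k < m\<close>] by simp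
  qed
  then have "(((*v) B) ^^ k) r0 = (1 / \<gamma>) *\<^sub>R ((r0 - B *v v) - resid k)"
    by (simp add: resid_split)
  moreover have "dir_span k \<subseteq> dir_span (Suc k)" by (rule dir_span_mono) simp
  ultimately show ?thesis
    using rest resid_in_dir_span_Suc[OF \<open>k < m\<close>] by (auto intro: span_scale span_diff)
qed

lemma residual_krylov_Suc_subset:
  assumes "k < m" and ON: "B_orthonormal k" and span: "dir_span k = residual_krylov k"
  shows "residual_krylov (Suc k) \<subseteq> dir_span (Suc k)"
  unfolding krylov_Suc
  using krylov_power_in_dir_span_Suc[OF assms] dir_span_mono[of k "Suc k"] span
  by (intro span_minimal) (auto simp: subspace_span)

lemma lanczos: "k \<le> m \<Longrightarrow> B_orthonormal k \<and> (\<forall>j\<le>k. dir_span j = residual_krylov j)"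
proof (induction k)
  case 0
  then show ?case by (simp add: B_orthonormal_def dirs_def bcg_dirs_def)
next
  case (Suc k)
  then have "k < m" and ON: "B_orthonormal k" and span: "\<And>j. j \<le> k \<Longrightarrow> dir_span j = residual_krylov j"
    by auto
  have "dir_span (Suc k) = residual_krylov (Suc k)"
    using dir_span_Suc_subset[OF ON span] residual_krylov_Suc_subset[OF \<open>k < m\<close> ON span] by auto
  then show ?case
    using B_orthonormal_Suc[OF \<open>k < m\<close> ON span] span by (auto simp: le_Suc_eq)
qed

lemma B_orthonormal_m: "B_orthonormal m"
  using lanczos[of m] by simp

lemma dir_span_m: "dir_span m = residual_krylov m"
  using lanczos[of m] by simp

lemma krylov_M_subset:
  "krylov ((*v) M) (M *v (x0 - x_star)) m \<subseteq> (\<lambda>v. (Sig ** transpose A) *v v) ` dir_span m"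
  unfolding krylov_def
proof (rule span_minimal)
  show "subspace ((\<lambda>v. (Sig ** transpose A) *v v) ` dir_span m)"
    by (intro linear_subspace_image matrix_vector_mul_linear subspace_span)
  have "- ((((*v) B) ^^ i) r0) \<in> dir_span m" if "i < m" for i
    using krylov_power[OF that, of "(*v) B" r0] by (simp add: dir_span_m subspace_neg[OF subspace_krylov])
  then show "(\<lambda>l. (((*v) M) ^^ l) (M *v (x0 - x_star))) ` {..<m}
      \<subseteq> (\<lambda>v. (Sig ** transpose A) *v v) ` dir_span m"
    by (auto simp: M_power_error simp flip: linear_neg[OF matrix_vector_mul_linear])
qed

lemma bcg_x_optimal:
  assumes "w \<in> krylov ((*v) M) (M *v (x0 - x_star)) m"
  shows "Bnorm (matrix_inv Sig) (bcg_x A Sig b x0 m - x_star)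
       \<le> Bnorm (matrix_inv Sig) (x0 - x_star + w)"
proof -
  define e where "e = bcg_x A Sig b x0 m - x_star"
  obtain v where v: "v \<in> dir_span m" "w = (Sig ** transpose A) *v v"
    using assms krylov_M_subset by blast
  define d where "d = v - proj m"
  have "d \<in> dir_span m" unfolding d_def using v(1) proj_in_dir_span by (rule span_diff)
  moreover have "A *v e = - resid m"
    by (simp add: e_def resid_def x_star_def matrix_vector_mult_diff_distrib
        matrix_vector_mul_inv_right[OF invertible_A])
  ultimately have "Binner (matrix_inv Sig) e ((Sig ** transpose A) *v d) = 0"
    using resid_orthogonal[OF B_orthonormal_m]
    by (simp add: Sig_inv.Binner_commute[of e] Binner_inv_Sig_adjoint)
  moreover have "x0 - x_star + w = e + (Sig ** transpose A) *v d"
    by (simp add: e_def d_def v(2) bcg_x_eq[OF B_orthonormal_m] matrix_vector_mult_diff_distrib)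
  ultimately have "Binner (matrix_inv Sig) (x0 - x_star + w) (x0 - x_star + w)
      = Binner (matrix_inv Sig) e e + Binner (matrix_inv Sig) ((Sig ** transpose A) *v d) ((Sig ** transpose A) *v d)"
    using Sig_inv.Binner_commute by (simp add: Binner_bilinear)
  then show ?thesis
    unfolding e_def[symmetric] Bnorm_Binner
    using Sig_inv.Binner_nonneg by (intro real_sqrt_le_mono) simp
qed

end

theorem proposition9:
  fixes A Sig0 :: "real^'n^'n" and b x0 :: "real^'n" and m :: nat
  assumes "invertible A"
    and "x0 \<noteq> matrix_inv A *v b"
    and "spd Sig0"
    and "\<forall>k\<in>{1..m}. bcg_stilde A Sig0 b x0 k \<noteq> 0"
  shows "Bnorm (matrix_inv Sig0) (bcg_x A Sig0 b x0 m - matrix_inv A *v b)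
           / Bnorm (matrix_inv Sig0) (x0 - matrix_inv A *v b)
         \<le> 2 * ((sqrt (cond2 (Sig0 ** transpose A ** A)) - 1)
                / (sqrt (cond2 (Sig0 ** transpose A ** A)) + 1)) ^ m"
proof -
  interpret bayescg_nonbreaking A Sig0 b x0 m
    using assms by unfold_locales auto
  obtain w where "w \<in> krylov ((*v) M) (M *v (x0 - x_star)) m"
    and "Bnorm (matrix_inv Sig0) (x0 - x_star + w)
      \<le> 2 * ((sqrt (cond2 M) - 1) / (sqrt (cond2 M) + 1)) ^ m * Bnorm (matrix_inv Sig0) (x0 - x_star)"
    using Sig_inv.krylov_cond2_bound[OF M_self_adjoint M_positive] by blast
  then have "Bnorm (matrix_inv Sig0) (bcg_x A Sig0 b x0 m - x_star)
      \<le> 2 * ((sqrt (cond2 M) - 1) / (sqrt (cond2 M) + 1)) ^ m * Bnorm (matrix_inv Sig0) (x0 - x_star)"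
    using bcg_x_optimal by (meson order_trans)
  moreover have "Bnorm (matrix_inv Sig0) (x0 - x_star) > 0"
    using assms(2) Sig_inv.Binner_pos by (simp add: Bnorm_Binner x_star_def)
  ultimately show ?thesis
    by (simp add: divide_le_eq x_star_def M_def)
qed

end
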